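(* The class $\mathcal K_\omega$ of all countable linear extensions of partial orders, i.e. countable structures $(P,<,\lhd)$ with $\lhd$ a strict partial order on $P$ and $<$ a strict linear order on $P$ extending $\lhd$, has the automorphic Borel amalgamation property (ABAP).
   Context: ABAP. Let $\mathcal K_\omega$ be a class of countable relational structures in a fixed countable relational language, closed under isomorphism; it is regarded as a standard Borel space in the usual way (coding structures with universe a subset of $\mathbb N$). For $A\in\mathcal K_\omega$, a quantifier-free type $\tau(x)$ in one free variable with finitely many parameters from $A$ is an admissible finite type over $A$ if there is $B\in\mathcal K_\omega$ with $A$ a substructure of $B$ and $B$ containing an element realizing $\tau$. The class $\mathcal K_\omega$ has the ABAP if there is a Borel map $E$ on $\mathcal K_\omega$ such that: (a) for every $A\in\mathcal K_\omega$, $E(A)\in\mathcal K_\omega$ is an extension of $A$ containing witnesses for all admissible finite types over $A$; (b) there is a Borel assignment $(A,\phi)\mapsto\tilde\phi$, from pairs with $A\in\mathcal K_\omega$ and $\phi\in\mathrm{Aut}(A)$, to $\tilde\phi\in\mathrm{Aut}(E(A))$ such that $\phi\subseteq\tilde\phi$ and $\tilde\phi$ has no fixed points in $E(A)\setminus A$; (c) there is an assignment $(A_0,A_1,\alpha)\mapsto\hat\alpha$, from triples with $A_i\in\mathcal K_\omega$ and $\alpha\colon A_0\cong A_1$ an isomorphism, to isomorphisms $\hat\alpha\colon E(A_0)\cong E(A_1)$ extending $\alpha$, such that whenever $\phi_i\in\mathrm{Aut}(A_i)$ and $\alpha\phi_0=\phi_1\alpha$, we have $\hat\alpha\tilde\phi_0=\tilde\phi_1\hat\alpha$.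 *)

theory Defs
  imports "HOL-Analysis.Analysis" "HOL-Library.Countable"
begin

section \<open>Countable relational structures\<close>

text \<open>
  A countable structure is coded by a structure whose universe is a (possibly finite or empty) subset
  of the natural numbers. The relation symbols are the elements of a countable type and
  \<open>ar\<close> is the arity function.
\<close>

record 'r rstruct =
  univ :: "nat set"
  rels :: "'r \<Rightarrow> nat list set"

definition structures :: "('r \<Rightarrow> nat) \<Rightarrow> 'r rstruct set" where
  "structures ar = {A. \<forall>r. rels A r \<subseteq> {xs. length xs = ar r \<and> set xs \<subseteq> univ A}}"

text \<open>
  A map with domain the universe of a structure is coded by a function that is
  \<^const>\<open>undefined\<close> off the universe, so that every such map has exactly one code.
\<close>

definition embeddings :: "'r rstruct \<Rightarrow> 'r rstruct \<Rightarrow> (nat \<Rightarrow> nat) set" where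
  "embeddings A B = {f \<in> extensional (univ A).
     inj_on f (univ A) \<and> f ` univ A \<subseteq> univ B \<and>
     (\<forall>r xs. set xs \<subseteq> univ A \<longrightarrow> (map f xs \<in> rels B r \<longleftrightarrow> xs \<in> rels A r))}"

definition isos :: "'r rstruct \<Rightarrow> 'r rstruct \<Rightarrow> (nat \<Rightarrow> nat) set" where
  "isos A B = {f \<in> embeddings A B. f ` univ A = univ B}"

definition auts :: "'r rstruct \<Rightarrow> (nat \<Rightarrow> nat) set" where
  "auts A = isos A A"


section \<open>The Borel space of codes\<close>

instance bool :: second_countable_topology
proof
  show "\<exists>B::bool set set. countable B \<and> open = generate_topology B"
  proof (intro exI conjI)
    show "countable (UNIV :: bool set set)"
      by (simp add: countable_finite)
    show "open = generate_topology (UNIV :: bool set set)"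
      by (intro ext) (auto simp: open_discrete intro: generate_topology.Basis)
  qed
qed

definition char_code :: "'r rstruct \<Rightarrow> (nat \<Rightarrow> bool) \<times> ('r \<times> nat list \<Rightarrow> bool)" where
  "char_code A = (\<lambda>n. n \<in> univ A, \<lambda>(r, xs). xs \<in> rels A r)"

definition struct_borel :: "('r::countable) rstruct set \<Rightarrow> 'r rstruct measure" where
  "struct_borel K = vimage_algebra K char_code borel"

definition borel_class :: "(('r::countable) \<Rightarrow> nat) \<Rightarrow> 'r rstruct set \<Rightarrow> bool" where
  "borel_class ar K \<longleftrightarrow>
     K \<in> sets (struct_borel (structures ar)) \<and>
     (\<forall>A\<in>K. \<forall>B\<in>structures ar. isos A B \<noteq> {} \<longrightarrow> B \<in> K)"

definition aut_pairs :: "'r rstruct set \<Rightarrow> ('r rstruct \<times> (nat \<Rightarrow> nat)) set" where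
  "aut_pairs K = {(A, \<phi>). A \<in> K \<and> \<phi> \<in> auts A}"

definition aut_borel ::
  "('r::countable) rstruct set \<Rightarrow> ('r rstruct \<times> (nat \<Rightarrow> nat)) measure" where
  "aut_borel K = restrict_space (struct_borel K \<Otimes>\<^sub>M borel) (aut_pairs K)"


section \<open>Quantifier-free types in one variable\<close>

datatype trm = Var | Par nat

datatype 'r qf =
    Eq trm trm
  | Rel 'r "trm list"
  | Bot
  | Neg "'r qf"
  | Conj "'r qf" "'r qf"

fun params_trm :: "trm \<Rightarrow> nat set" where
  "params_trm Var = {}"
| "params_trm (Par p) = {p}"

fun params :: "'r qf \<Rightarrow> nat set" where
  "params (Eq s t) = params_trm s \<union> params_trm t"
| "params (Rel r ts) = (\<Union>t\<in>set ts. params_trm t)"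
| "params Bot = {}"
| "params (Neg f) = params f"
| "params (Conj f g) = params f \<union> params g"

fun wf_qf :: "('r \<Rightarrow> nat) \<Rightarrow> 'r qf \<Rightarrow> bool" where
  "wf_qf ar (Eq s t) \<longleftrightarrow> True"
| "wf_qf ar (Rel r ts) \<longleftrightarrow> length ts = ar r"
| "wf_qf ar Bot \<longleftrightarrow> True"
| "wf_qf ar (Neg f) \<longleftrightarrow> wf_qf ar f"
| "wf_qf ar (Conj f g) \<longleftrightarrow> wf_qf ar f \<and> wf_qf ar g"

text \<open>In \<open>sat B e b f\<close>, the parameter \<open>p\<close> denotes \<open>e p\<close> and the variable denotes \<open>b\<close>.\<close>

fun val :: "(nat \<Rightarrow> nat) \<Rightarrow> nat \<Rightarrow> trm \<Rightarrow> nat" where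
  "val e b Var = b"
| "val e b (Par p) = e p"

fun sat :: "'r rstruct \<Rightarrow> (nat \<Rightarrow> nat) \<Rightarrow> nat \<Rightarrow> 'r qf \<Rightarrow> bool" where
  "sat B e b (Eq s t) \<longleftrightarrow> val e b s = val e b t"
| "sat B e b (Rel r ts) \<longleftrightarrow> map (val e b) ts \<in> rels B r"
| "sat B e b Bot \<longleftrightarrow> False"
| "sat B e b (Neg f) \<longleftrightarrow> \<not> sat B e b f"
| "sat B e b (Conj f g) \<longleftrightarrow> sat B e b f \<and> sat B e b g"

definition realizes :: "'r rstruct \<Rightarrow> (nat \<Rightarrow> nat) \<Rightarrow> nat \<Rightarrow> 'r qf set \<Rightarrow> bool" where
  "realizes B e b \<tau> \<longleftrightarrow> b \<in> univ B \<and> (\<forall>f\<in>\<tau>. sat B e b f)"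

text \<open>
  A type is a set of quantifier-free formulas, complete or not, with only finitely many
  parameters altogether. Extensions are given by embeddings: a structure whose universe is all of
  the natural numbers has no proper extension, in the literal sense, among the codes.
\<close>

definition admissible_type ::
  "('r \<Rightarrow> nat) \<Rightarrow> 'r rstruct set \<Rightarrow> 'r rstruct \<Rightarrow> 'r qf set \<Rightarrow> bool" where
  "admissible_type ar K A \<tau> \<longleftrightarrow>
     (\<forall>f\<in>\<tau>. wf_qf ar f) \<and>
     finite (\<Union>f\<in>\<tau>. params f) \<and> (\<Union>f\<in>\<tau>. params f) \<subseteq> univ A \<and>
     (\<exists>B\<in>K. \<exists>e\<in>embeddings A B. \<exists>b\<in>univ B. realizes B e b \<tau>)"


section \<open>The automorphic Borel amalgamation property\<close>

text \<open>
  The inclusion of \<open>A\<close> in its extension \<open>E A\<close> is coded by an embedding \<open>\<iota> A\<close>, which is part of the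
  value of the Borel map at \<open>A\<close> and therefore depends on \<open>A\<close> in a Borel way.
  \<open>T A \<phi>\<close> stands for \<open>\<phi>\<close> with a tilde, \<open>H A\<^sub>0 A\<^sub>1 \<alpha>\<close> for \<open>\<alpha>\<close> with a hat. No measurability is
  required of \<open>H\<close>.
\<close>

definition ABAP :: "(('r::countable) \<Rightarrow> nat) \<Rightarrow> 'r rstruct set \<Rightarrow> bool" where
  "ABAP ar K \<longleftrightarrow> borel_class ar K \<and>
     (\<exists>(E :: 'r rstruct \<Rightarrow> 'r rstruct) (\<iota> :: 'r rstruct \<Rightarrow> nat \<Rightarrow> nat)
       (T :: 'r rstruct \<Rightarrow> (nat \<Rightarrow> nat) \<Rightarrow> nat \<Rightarrow> nat)
       (H :: 'r rstruct \<Rightarrow> 'r rstruct \<Rightarrow> (nat \<Rightarrow> nat) \<Rightarrow> nat \<Rightarrow> nat).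
        E \<in> struct_borel K \<rightarrow>\<^sub>M struct_borel K \<and>
        \<iota> \<in> struct_borel K \<rightarrow>\<^sub>M borel \<and>
        (\<forall>A\<in>K. E A \<in> K \<and> \<iota> A \<in> embeddings A (E A) \<and>
           (\<forall>\<tau>. admissible_type ar K A \<tau> \<longrightarrow> (\<exists>b\<in>univ (E A). realizes (E A) (\<iota> A) b \<tau>))) \<and>
        (\<lambda>(A, \<phi>). T A \<phi>) \<in> aut_borel K \<rightarrow>\<^sub>M borel \<and>
        (\<forall>A\<in>K. \<forall>\<phi>\<in>auts A.
           T A \<phi> \<in> auts (E A) \<and>
           (\<forall>x\<in>univ A. T A \<phi> (\<iota> A x) = \<iota> A (\<phi> x)) \<and>
           (\<forall>y\<in>univ (E A) - \<iota> A ` univ A. T A \<phi> y \<noteq> y)) \<and>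
        (\<forall>A\<^sub>0\<in>K. \<forall>A\<^sub>1\<in>K. \<forall>\<alpha>\<in>isos A\<^sub>0 A\<^sub>1.
           H A\<^sub>0 A\<^sub>1 \<alpha> \<in> isos (E A\<^sub>0) (E A\<^sub>1) \<and>
           (\<forall>x\<in>univ A\<^sub>0. H A\<^sub>0 A\<^sub>1 \<alpha> (\<iota> A\<^sub>0 x) = \<iota> A\<^sub>1 (\<alpha> x)) \<and>
           (\<forall>\<phi>\<^sub>0\<in>auts A\<^sub>0. \<forall>\<phi>\<^sub>1\<in>auts A\<^sub>1.
              (\<forall>x\<in>univ A\<^sub>0. \<alpha> (\<phi>\<^sub>0 x) = \<phi>\<^sub>1 (\<alpha> x)) \<longrightarrow>
              (\<forall>y\<in>univ (E A\<^sub>0).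
                 H A\<^sub>0 A\<^sub>1 \<alpha> (T A\<^sub>0 \<phi>\<^sub>0 y) = T A\<^sub>1 \<phi>\<^sub>1 (H A\<^sub>0 A\<^sub>1 \<alpha> y)))))"


section \<open>Linear extensions of partial orders\<close>

datatype order_sym = Lin | Part

instance order_sym :: countable
  by countable_datatype

definition order_arity :: "order_sym \<Rightarrow> nat" where
  "order_arity s = 2"

definition brel :: "'r rstruct \<Rightarrow> 'r \<Rightarrow> (nat \<times> nat) set" where
  "brel A r = {(x, y). [x, y] \<in> rels A r}"

definition linear_extensions :: "order_sym rstruct set" where
  "linear_extensions = {A \<in> structures order_arity.
     irrefl (brel A Part) \<and> trans (brel A Part) \<and>
     strict_linear_order_on (univ A) (brel A Lin) \<and>
     brel A Part \<subseteq> brel A Lin}"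

end

theory Submission
  imports Defs
begin

text \<open>
  A one-point extension of a finite suborder is described by finite sets \<open>D\<close> and \<open>U\<close> of parameters
  below and above the new point in the partial order, together with the largest parameter \<open>a\<close> below
  it in the linear order. Insert immediately above \<open>a\<close> a copy of the integers for each such
  description, relate new points in the partial order only through elements of \<open>A\<close>, and order the
  points with the same \<open>a\<close> lexicographically, which is possible canonically because \<open>A\<close> is linearly
  ordered. Isomorphisms then act on the descriptions, and the extension of an automorphism
  additionally shifts the integer coordinate; the shift moves every new point and commutes with the
  action of all isomorphisms. Descriptions are made of lists rather than sets, so that they are
  countably many codes compared by the lexicographic order on lists; repetitions are harmless.
\<close>

section \<open>Lexicographic orders on lists\<close>

lemma total_on_lexord:
  assumes "total_on S r"
  shows "total_on (lists S) (lexord r)"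
proof -
  have "(xs, ys) \<in> lexord r \<or> xs = ys \<or> (ys, xs) \<in> lexord r"
    if "xs \<in> lists S" "ys \<in> lists S" for xs ys
    using that
  proof (induction xs arbitrary: ys)
    case Nil
    then show ?case by (cases ys) auto
  next
    case (Cons x xs)
    then show ?case
      using assms by (cases ys) (auto simp: total_on_def)
  qed
  then show ?thesis
    by (auto simp: total_on_def)
qed

text \<open>Relativized to \<open>S\<close> so that it iterates: once for elements, then again with
  \<open>map f\<close> and \<open>lists S\<close> in place of \<open>f\<close> and
  \<open>S\<close>.\<close>

lemma lexord_map_iff:
  assumes "inj_on f S"
    and "\<And>x y. x \<in> S \<Longrightarrow> y \<in> S \<Longrightarrow> (f x, f y) \<in> r' \<longleftrightarrow> (x, y) \<in> r"
    and "xs \<in> lists S" "ys \<in> lists S"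
  shows "(map f xs, map f ys) \<in> lexord r' \<longleftrightarrow> (xs, ys) \<in> lexord r"
  using assms(3,4)
proof (induction xs arbitrary: ys)
  case Nil
  then show ?case by (cases ys) auto
next
  case (Cons x xs)
  then show ?case
    using assms(1,2) by (cases ys) (auto simp: inj_on_eq_iff)
qed

section \<open>Adjoining points to a linear extension\<close>

text \<open>
  \<open>New p D U k\<close> is a point placed immediately above the head of \<open>p\<close> (below all old points if \<open>p\<close> is
  empty), above the elements of \<open>D\<close> and below those of \<open>U\<close> in the partial order. The integer \<open>k\<close>
  is invisible to the partial order and only serves to be moved.
\<close>

datatype 'a point = Old 'a | New "'a list" "'a list" "'a list" int

instance point :: (countable) countable
  by countable_datatype

text \<open>Sort key of the linear order. \<open>[[a]]\<close> is a proper prefix of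
  \<open>[[a], D, U]\<close> and so precedes it, while \<open>[[b]]\<close> with \<open>b\<close>
  above \<open>a\<close> follows it; an entry \<open>[]\<close> in front precedes every
  \<open>[a]\<close>. Thus no old point separates a new point from the head of its \<open>p\<close>.
  The integer only breaks ties.\<close>

fun key :: "'a point \<Rightarrow> 'a list list \<times> int" where
  "key (Old a) = ([[a]], 0)"
| "key (New p D U k) = ([p, D, U], k)"

text \<open>An old point serves as its own lower bound here and as its own upper bound in
  \<open>hi\<close>, so that old and new points obey the same formulas.\<close>

fun lo :: "'a point \<Rightarrow> 'a list" where
  "lo (Old a) = [a]"
| "lo (New p D U k) = D"

fun hi :: "'a point \<Rightarrow> 'a list" where
  "hi (Old a) = [a]"
| "hi (New p D U k) = U"

fun shift :: "'a point \<Rightarrow> 'a point" where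
  "shift (Old a) = Old a"
| "shift (New p D U k) = New p D U (k + 1)"

fun unshift :: "'a point \<Rightarrow> 'a point" where
  "unshift (Old a) = Old a"
| "unshift (New p D U k) = New p D U (k - 1)"

definition lin :: "('a \<times> 'a) set \<Rightarrow> ('a point \<times> 'a point) set" where
  "lin r = inv_image (lexord (lexord r) <*lex*> {(i, j). i < j}) key"

text \<open>The weak comparison of \<open>u\<close> and \<open>d\<close> puts a new point above its
  \<open>D\<close> and below its \<open>U\<close>; \<open>s \<noteq> t\<close> removes the loops
  that this creates at old points.\<close>

definition part :: "('a \<times> 'a) set \<Rightarrow> ('a point \<times> 'a point) set" where
  "part q = {(s, t). s \<noteq> t \<and> (\<exists>u\<in>set (hi s). \<exists>d\<in>set (lo t). u = d \<or> (u, d) \<in> q)}"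

text \<open>The comparisons of keys place the point between \<open>D\<close> and \<open>U\<close> in
  \<open>lin r\<close>, which yields the inclusion of \<open>part q\<close> in \<open>lin r\<close>.
  The last condition carries transitivity of \<open>part q\<close> through the point.\<close>

fun consistent :: "'a set \<Rightarrow> ('a \<times> 'a) set \<Rightarrow> ('a \<times> 'a) set \<Rightarrow> 'a point \<Rightarrow> bool" where
  "consistent S r q (Old a) \<longleftrightarrow> a \<in> S"
| "consistent S r q (New p D U k) \<longleftrightarrow>
     (\<forall>x\<in>set p. x \<in> S) \<and> (\<forall>x\<in>set D. x \<in> S) \<and> (\<forall>x\<in>set U. x \<in> S) \<and>
     (\<forall>d\<in>set D. ([[d]], [p, D, U]) \<in> lexord (lexord r)) \<and>
     (\<forall>u\<in>set U. ([p, D, U], [[u]]) \<in> lexord (lexord r)) \<and>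
     (\<forall>d\<in>set D. \<forall>u\<in>set U. (d, u) \<in> q)"

lemma key_eq_iff: "key s = key t \<longleftrightarrow> s = t"
  by (cases s; cases t) auto

lemma set_point_consistent: "consistent S r q s \<Longrightarrow> set_point s \<subseteq> S"
  by (cases s) auto

lemma consistent_shift [simp]: "consistent S r q (shift s) \<longleftrightarrow> consistent S r q s"
  by (cases s) auto

lemma consistent_unshift [simp]: "consistent S r q (unshift s) \<longleftrightarrow> consistent S r q s"
  by (cases s) auto

lemma shift_unshift [simp]: "shift (unshift s) = s"
  by (cases s) auto

lemma unshift_shift [simp]: "unshift (shift s) = s"
  by (cases s) auto

lemma shift_inject [simp]: "shift s = shift t \<longleftrightarrow> s = t"
  by (metis unshift_shift)

text \<open>Integers matter only between points with the same \<open>p\<close>, \<open>D\<close>,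
  \<open>U\<close>, and there both move by one; the keys of an old and a new point differ already in
  their list parts.\<close>

lemma shift_in_lin [simp]: "(shift s, shift t) \<in> lin r \<longleftrightarrow> (s, t) \<in> lin r"
  by (cases s; cases t) (auto simp: lin_def)

lemma lo_shift [simp]: "lo (shift s) = lo s"
  by (cases s) auto

lemma hi_shift [simp]: "hi (shift s) = hi s"
  by (cases s) auto

lemma shift_in_part [simp]: "(shift s, shift t) \<in> part q \<longleftrightarrow> (s, t) \<in> part q"
  by (simp add: part_def)

lemma shift_map_point: "shift (map_point f s) = map_point f (shift s)"
  by (cases s) auto

lemma lo_map_point: "lo (map_point f s) = map f (lo s)"
  by (cases s) auto

lemma hi_map_point: "hi (map_point f s) = map f (hi s)"
  by (cases s) auto

lemma key_map_point: "key (map_point f s) = map_prod (map (map f)) id (key s)"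
  by (cases s) auto

lemma set_lo_consistent: "consistent S r q s \<Longrightarrow> set (lo s) \<subseteq> S"
  by (cases s) auto

lemma set_hi_consistent: "consistent S r q s \<Longrightarrow> set (hi s) \<subseteq> S"
  by (cases s) auto

lemma key_consistent: "consistent S r q s \<Longrightarrow> fst (key s) \<in> lists (lists S)"
  by (cases s) auto

lemma map_point_inject:
  assumes "inj_on f S" "consistent S r q s" "consistent S r q t"
  shows "map_point f s = map_point f t \<longleftrightarrow> s = t"
  using point.inj_map_strong[of s t f f] inj_onD[OF assms(1)]
    set_point_consistent[OF assms(2)] set_point_consistent[OF assms(3)]
  by blast

section \<open>Order embeddings act on points\<close>

context
  fixes S :: "'a set" and r q :: "('a \<times> 'a) set"
    and S' :: "'b set" and r' q' :: "('b \<times> 'b) set" and f :: "'a \<Rightarrow> 'b"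
  assumes inj: "inj_on f S" and img: "f ` S \<subseteq> S'"
    and r: "\<And>x y. x \<in> S \<Longrightarrow> y \<in> S \<Longrightarrow> (f x, f y) \<in> r' \<longleftrightarrow> (x, y) \<in> r"
    and q: "\<And>x y. x \<in> S \<Longrightarrow> y \<in> S \<Longrightarrow> (f x, f y) \<in> q' \<longleftrightarrow> (x, y) \<in> q"
begin

lemma lexord_lexord_map:
  assumes "xs \<in> lists (lists S)" "ys \<in> lists (lists S)"
  shows "(map (map f) xs, map (map f) ys) \<in> lexord (lexord r') \<longleftrightarrow> (xs, ys) \<in> lexord (lexord r)"
proof (rule lexord_map_iff[OF inj_on_map_lists[OF inj] _ assms])
  show "(map f us, map f vs) \<in> lexord r' \<longleftrightarrow> (us, vs) \<in> lexord r"
    if "us \<in> lists S" "vs \<in> lists S" for us vs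
    by (rule lexord_map_iff[OF inj r that])
qed

lemma consistent_map_point:
  assumes "consistent S r q s"
  shows "consistent S' r' q' (map_point f s)"
proof (cases s)
  case (New p D U k)
  have "([[f d]], map (map f) [p, D, U]) \<in> lexord (lexord r')" if "d \<in> set D" for d
    using lexord_lexord_map[of "[[d]]" "[p, D, U]"] that assms New by (auto simp del: lexord_cons_cons)
  moreover have "(map (map f) [p, D, U], [[f u]]) \<in> lexord (lexord r')" if "u \<in> set U" for u
    using lexord_lexord_map[of "[p, D, U]" "[[u]]"] that assms New by (auto simp del: lexord_cons_cons)
  ultimately show ?thesis
    using assms img q New by (auto simp del: lexord_cons_cons)
qed (use assms img in auto)

lemma map_point_in_lin:
  assumes "consistent S r q s" "consistent S r q t"
  shows "(map_point f s, map_point f t) \<in> lin r' \<longleftrightarrow> (s, t) \<in> lin r"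
proof -
  \<comment> \<open>Ties between list parts, where the integers decide, are neither created nor
    destroyed by \<open>f\<close>.\<close>
  have "map (map f) (fst (key s)) = map (map f) (fst (key t)) \<longleftrightarrow> fst (key s) = fst (key t)"
    by (rule inj_on_eq_iff[OF inj_on_map_lists[OF inj_on_map_lists[OF inj]]])
      (use key_consistent assms in blast)+
  then show ?thesis
    using lexord_lexord_map[OF key_consistent[OF assms(1)] key_consistent[OF assms(2)]]
    by (simp add: lin_def key_map_point lex_prod_def case_prod_beta)
qed

lemma map_point_in_part:
  assumes "consistent S r q s" "consistent S r q t"
  shows "(map_point f s, map_point f t) \<in> part q' \<longleftrightarrow> (s, t) \<in> part q"
proof -
  have "(f u = f d \<or> (f u, f d) \<in> q') \<longleftrightarrow> (u = d \<or> (u, d) \<in> q)"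
    if "u \<in> set (hi s)" "d \<in> set (lo t)" for u d
    using that set_hi_consistent[OF assms(1)] set_lo_consistent[OF assms(2)] inj q
    by (metis inj_onD subsetD)
  then show ?thesis
    using map_point_inject[OF inj assms] by (simp add: part_def lo_map_point hi_map_point)
qed

end

section \<open>The order axioms for points\<close>

locale linear_extension =
  fixes S :: "'a set" and r q :: "('a \<times> 'a) set"
  assumes trans_r: "trans r" and irrefl_r: "irrefl r" and total_r: "total_on S r"
    and trans_q: "trans q" and q_subset: "q \<subseteq> r"
begin

lemma trans_lin: "trans (lin r)"
  unfolding lin_def
  by (intro trans_inv_image trans_lex_prod lexord_transI trans_r) (auto simp: trans_def)

lemma irrefl_lin: "irrefl (lin r)"
proof -
  have "(xs, xs) \<notin> lexord (lexord r)" for xs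
    using irrefl_r by (intro lexord_irreflexive allI) (auto simp: irrefl_def)
  then show ?thesis
    by (simp add: irrefl_def lin_def lex_prod_def case_prod_beta)
qed

text \<open>The list parts of the keys are totally ordered; where they agree, distinct points have
  distinct integers, since \<open>key\<close> is injective.\<close>

lemma total_lin: "total_on {s. consistent S r q s} (lin r)"
proof -
  have "(s, t) \<in> lin r \<or> (t, s) \<in> lin r" if "consistent S r q s" "consistent S r q t" "s \<noteq> t" for s t
  proof -
    have "fst (key s) = fst (key t) \<or> (fst (key s), fst (key t)) \<in> lexord (lexord r) \<or>
        (fst (key t), fst (key s)) \<in> lexord (lexord r)"
      using total_on_lexord[OF total_on_lexord[OF total_r]] key_consistent[OF that(1)] key_consistent[OF that(2)]
      by (metis total_on_def)
    moreover have "key s \<noteq> key t"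
      using that(3) by (simp add: key_eq_iff)
    ultimately show ?thesis
      by (auto simp: lin_def lex_prod_def case_prod_beta prod_eq_iff)
  qed
  then show ?thesis
    by (auto simp: total_on_def)
qed

lemma lo_le:
  assumes "consistent S r q s" "d \<in> set (lo s)"
  shows "Old d = s \<or> (Old d, s) \<in> lin r"
  using assms by (cases s) (auto simp: lin_def)

lemma le_hi:
  assumes "consistent S r q s" "u \<in> set (hi s)"
  shows "s = Old u \<or> (s, Old u) \<in> lin r"
  using assms by (cases s) (auto simp: lin_def)

lemma lo_hi:
  assumes "consistent S r q s" "d \<in> set (lo s)" "u \<in> set (hi s)"
  shows "d = u \<or> (d, u) \<in> q"
  using assms by (cases s) auto

text \<open>The witnesses give a chain \<open>s \<le> Old u \<le> Old d \<le> t\<close> in the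
  linear order, and \<open>s \<noteq> t\<close> makes one of its steps strict.\<close>

lemma part_subset_lin:
  assumes "consistent S r q s" "consistent S r q t" "(s, t) \<in> part q"
  shows "(s, t) \<in> lin r"
proof -
  obtain u d where u: "u \<in> set (hi s)" and d: "d \<in> set (lo t)" and "u = d \<or> (u, d) \<in> q" and "s \<noteq> t"
    using assms(3) by (auto simp: part_def)
  then have "Old u = Old d \<or> (Old u, Old d) \<in> lin r"
    using q_subset by (auto simp: lin_def)
  with le_hi[OF assms(1) u] lo_le[OF assms(2) d] \<open>s \<noteq> t\<close> trans_lin
  show ?thesis
    by (metis transD)
qed

text \<open>Consistency of the middle point joins the two pairs of witnesses:
  \<open>u \<le> d\<close>, then \<open>d \<le> u'\<close> because these are bounds of
  \<open>t\<close>, then \<open>u' \<le> d'\<close>.\<close>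

lemma part_trans:
  assumes "consistent S r q s" "consistent S r q t" "consistent S r q w" "(s, t) \<in> part q" "(t, w) \<in> part q"
  shows "(s, w) \<in> part q"
proof -
  \<comment> \<open>A return to \<open>s\<close> would be a cycle in the linear order.\<close>
  have "s \<noteq> w"
    using part_subset_lin assms trans_lin irrefl_lin by (metis irrefl_def transD)
  obtain u d where "u \<in> set (hi s)" "d \<in> set (lo t)" "u = d \<or> (u, d) \<in> q"
    using assms(4) by (auto simp: part_def)
  moreover obtain u' d' where "u' \<in> set (hi t)" "d' \<in> set (lo w)" "u' = d' \<or> (u', d') \<in> q"
    using assms(5) by (auto simp: part_def)
  moreover have "d = u' \<or> (d, u') \<in> q"
    using lo_hi assms(2) calculation by blast
  ultimately show ?thesis
    using \<open>s \<noteq> w\<close> transD[OF trans_q] unfolding part_def by blast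
qed

end

section \<open>The extension of a coded structure\<close>

lemma brel_subset:
  assumes "A \<in> structures order_arity"
  shows "brel A r \<subseteq> univ A \<times> univ A"
  using assms unfolding structures_def brel_def by fastforce

text \<open>All arities are 2, so lists of any other length lie in no relation of either structure
  and only pairs need comparing.\<close>

lemma embeddings_iff:
  assumes A: "A \<in> structures order_arity" and B: "B \<in> structures order_arity"
  shows "f \<in> embeddings A B \<longleftrightarrow> f \<in> extensional (univ A) \<and> inj_on f (univ A) \<and>
    f ` univ A \<subseteq> univ B \<and>
    (\<forall>r. \<forall>x\<in>univ A. \<forall>y\<in>univ A. (f x, f y) \<in> brel B r \<longleftrightarrow> (x, y) \<in> brel A r)"
proof -
  have "(\<forall>xs. set xs \<subseteq> univ A \<longrightarrow> (map f xs \<in> rels B r \<longleftrightarrow> xs \<in> rels A r)) \<longleftrightarrow>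
      (\<forall>x\<in>univ A. \<forall>y\<in>univ A. (f x, f y) \<in> brel B r \<longleftrightarrow> (x, y) \<in> brel A r)" (is "?L \<longleftrightarrow> ?R") for r
  proof
    assume L: ?L
    have "(f x, f y) \<in> brel B r \<longleftrightarrow> (x, y) \<in> brel A r" if "x \<in> univ A" "y \<in> univ A" for x y
      using L[rule_format, of "[x, y]"] that by (simp add: brel_def)
    then show ?R
      by blast
  next
    assume R: ?R
    have "map f xs \<in> rels B r \<longleftrightarrow> xs \<in> rels A r" if "set xs \<subseteq> univ A" for xs
    proof (cases "length xs = 2")
      case True
      then obtain x y where "xs = [x, y]"
        by (auto simp: numeral_2_eq_2 length_Suc_conv)
      then show ?thesis
        using R that by (simp add: brel_def)
    next
      case False
      then have "length (map f xs) \<noteq> 2"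
        by simp
      with False show ?thesis
        using A B unfolding structures_def order_arity_def by blast
    qed
    then show ?L
      by blast
  qed
  then show ?thesis
    by (simp add: embeddings_def)
qed

lemma isos_iff:
  assumes "A \<in> structures order_arity" "B \<in> structures order_arity"
  shows "f \<in> isos A B \<longleftrightarrow> f \<in> extensional (univ A) \<and> bij_betw f (univ A) (univ B) \<and>
    (\<forall>r. \<forall>x\<in>univ A. \<forall>y\<in>univ A. (f x, f y) \<in> brel B r \<longleftrightarrow> (x, y) \<in> brel A r)"
  using embeddings_iff[OF assms] by (auto simp: isos_def bij_betw_def)

lemma linear_extensions_structures: "A \<in> linear_extensions \<Longrightarrow> A \<in> structures order_arity"
  by (simp add: linear_extensions_def)

lemma linear_extension_brel:
  assumes "A \<in> linear_extensions"
  shows "linear_extension (univ A) (brel A Lin) (brel A Part)"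
  using assms by unfold_locales (auto simp: linear_extensions_def strict_linear_order_on_def)

lemma linear_extensions_iso_closed:
  assumes "A \<in> linear_extensions" "B \<in> structures order_arity" "f \<in> isos A B"
  shows "B \<in> linear_extensions"
proof -
  interpret linear_extension "univ A" "brel A Lin" "brel A Part"
    using linear_extension_brel assms(1) .
  note A = linear_extensions_structures[OF assms(1)]
  have f: "f ` univ A = univ B" "inj_on f (univ A)"
    and brel: "\<And>r x y. x \<in> univ A \<Longrightarrow> y \<in> univ A \<Longrightarrow> (f x, f y) \<in> brel B r \<longleftrightarrow> (x, y) \<in> brel A r"
    using assms(3) by (auto simp: isos_iff[OF A assms(2)] bij_betw_def)
  \<comment> \<open>Surjectivity pulls related pairs of \<open>B\<close> back to related pairs of
    \<open>A\<close>; transitivity, irreflexivity and the inclusion are reduced to \<open>A\<close>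
    in this way.\<close>
  have img: "\<exists>x x'. x \<in> univ A \<and> x' \<in> univ A \<and> y = f x \<and> y' = f x' \<and> (x, x') \<in> brel A r"
    if "(y, y') \<in> brel B r" for y y' r
  proof -
    have "y \<in> f ` univ A" "y' \<in> f ` univ A"
      using that brel_subset[OF assms(2), of r] f(1) by auto
    then show ?thesis
      using that brel by blast
  qed
  have trans: "trans (brel B r)" if "trans (brel A r)" for r
  proof (rule transI)
    fix x y z
    assume "(x, y) \<in> brel B r" "(y, z) \<in> brel B r"
    then obtain u v v' w where "u \<in> univ A" "v \<in> univ A" "v' \<in> univ A" "w \<in> univ A"
      "x = f u" "y = f v" "y = f v'" "z = f w" "(u, v) \<in> brel A r" "(v', w) \<in> brel A r"
      using img by metis
    moreover from this have "v = v'"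
      using f(2) by (metis inj_onD)
    ultimately show "(x, z) \<in> brel B r"
      using brel that by (metis transD)
  qed
  have subset: "brel B Part \<subseteq> brel B Lin"
  proof clarify
    fix x y
    assume "(x, y) \<in> brel B Part"
    then show "(x, y) \<in> brel B Lin"
      using img brel q_subset by (metis subsetD)
  qed
  moreover have "irrefl (brel B Lin)"
  proof (rule irreflI)
    fix y
    show "(y, y) \<notin> brel B Lin"
    proof
      assume "(y, y) \<in> brel B Lin"
      then obtain x x' where "x \<in> univ A" "x' \<in> univ A" "y = f x" "y = f x'" "(x, x') \<in> brel A Lin"
        using img by blast
      then show False
        using f(2) irrefl_r by (metis inj_onD irreflD)
    qed
  qed
  moreover from this subset have "irrefl (brel B Part)"
    by (auto simp: irrefl_def)
  moreover have "total_on (univ B) (brel B Lin)"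
    using total_r by (fastforce simp: f(1)[symmetric] total_on_def brel)
  ultimately show ?thesis
    using trans[OF trans_q] trans[OF trans_r] assms(2)
    by (simp add: linear_extensions_def strict_linear_order_on_def)
qed

abbreviation points :: "order_sym rstruct \<Rightarrow> nat point set" where
  "points A \<equiv> {s. consistent (univ A) (brel A Lin) (brel A Part) s}"

fun point_rel :: "order_sym rstruct \<Rightarrow> order_sym \<Rightarrow> (nat point \<times> nat point) set" where
  "point_rel A Lin = lin (brel A Lin)"
| "point_rel A Part = part (brel A Part)"

text \<open>Points are countable in number and are coded by naturals, so an old element
  \<open>n\<close> gets the new name \<open>to_nat (Old n)\<close>, which \<open>incl\<close>
  records.\<close>

definition ext :: "order_sym rstruct \<Rightarrow> order_sym rstruct" where
  "ext A = \<lparr>univ = to_nat ` points A,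
     rels = \<lambda>r. {[to_nat s, to_nat t] | s t. s \<in> points A \<and> t \<in> points A \<and> (s, t) \<in> point_rel A r}\<rparr>"

definition incl :: "order_sym rstruct \<Rightarrow> nat \<Rightarrow> nat" where
  "incl A = (\<lambda>n\<in>univ A. to_nat (Old n))"

text \<open>A map of points read as a map of codes, with value \<open>undefined\<close> off the
  universe as the coding of maps demands.\<close>

definition transport :: "order_sym rstruct \<Rightarrow> (nat point \<Rightarrow> nat point) \<Rightarrow> nat \<Rightarrow> nat" where
  "transport A g = (\<lambda>n\<in>univ (ext A). to_nat (g (from_nat n)))"

lemma univ_ext: "univ (ext A) = to_nat ` points A"
  by (simp add: ext_def)

lemma brel_ext:
  "brel (ext A) r = {(to_nat s, to_nat t) | s t. s \<in> points A \<and> t \<in> points A \<and> (s, t) \<in> point_rel A r}"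
  by (auto simp: ext_def brel_def)

lemma brel_ext_iff:
  assumes "s \<in> points A" "t \<in> points A"
  shows "(to_nat s, to_nat t) \<in> brel (ext A) r \<longleftrightarrow> (s, t) \<in> point_rel A r"
  using assms by (auto simp: brel_ext)

lemma transport_to_nat: "s \<in> points A \<Longrightarrow> transport A g (to_nat s) = to_nat (g s)"
  by (simp add: transport_def univ_ext)

lemma ext_structures: "ext A \<in> structures order_arity"
  by (auto simp: structures_def ext_def order_arity_def)

lemma ext_linear_extensions:
  assumes "A \<in> linear_extensions"
  shows "ext A \<in> linear_extensions"
proof -
  interpret linear_extension "univ A" "brel A Lin" "brel A Part"
    using linear_extension_brel assms .
  have trans: "trans (brel (ext A) r)"
    if "\<And>s t w. s \<in> points A \<Longrightarrow> t \<in> points A \<Longrightarrow> w \<in> points A \<Longrightarrow>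
      (s, t) \<in> point_rel A r \<Longrightarrow> (t, w) \<in> point_rel A r \<Longrightarrow> (s, w) \<in> point_rel A r" for r
  proof (rule transI)
    fix x y z
    assume "(x, y) \<in> brel (ext A) r" "(y, z) \<in> brel (ext A) r"
    then obtain s t t' w where "s \<in> points A" "t \<in> points A" "t' \<in> points A" "w \<in> points A"
      "(s, t) \<in> point_rel A r" "(t', w) \<in> point_rel A r"
      and eq: "x = to_nat s" "y = to_nat t" "y = to_nat t'" "z = to_nat w"
      unfolding brel_ext by blast
    moreover have "t' = t"
      using eq(2,3) by simp
    ultimately have "s \<in> points A" "w \<in> points A" "(s, w) \<in> point_rel A r"
      using that[of s t w] by simp_all
    then show "(x, z) \<in> brel (ext A) r"
      unfolding brel_ext eq by blast
  qed
  have subset: "brel (ext A) Part \<subseteq> brel (ext A) Lin"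
    using part_subset_lin by (fastforce simp: brel_ext)
  moreover have "irrefl (brel (ext A) Lin)"
    using irrefl_lin by (auto simp: irrefl_def brel_ext)
  moreover from this subset have "irrefl (brel (ext A) Part)"
    by (auto simp: irrefl_def)
  moreover have "total_on (univ (ext A)) (brel (ext A) Lin)"
    using total_lin by (auto simp: total_on_def univ_ext brel_ext)
  moreover have "trans (brel (ext A) Lin)"
    by (rule trans, simp, rule transD[OF trans_lin])
  moreover have "trans (brel (ext A) Part)"
    by (rule trans, simp, rule part_trans)
  ultimately show ?thesis
    using ext_structures by (simp add: linear_extensions_def strict_linear_order_on_def)
qed

lemma incl_embedding:
  assumes "A \<in> structures order_arity" "irrefl (brel A Part)"
  shows "incl A \<in> embeddings A (ext A)"
proof -
  \<comment> \<open>For \<open>Lin\<close>, \<open>[[x]]\<close> is compared with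
    \<open>[[y]]\<close>. For \<open>Part\<close>, irreflexivity matches the clause
    \<open>s \<noteq> t\<close>, which cuts the weak comparison back to the strict one.\<close>
  have "(Old x, Old y) \<in> point_rel A r \<longleftrightarrow> (x, y) \<in> brel A r" for x y r
    using assms(2) by (cases r) (auto simp: lin_def part_def irrefl_def)
  then have "(to_nat (Old x), to_nat (Old y)) \<in> brel (ext A) r \<longleftrightarrow> (x, y) \<in> brel A r"
    if "x \<in> univ A" "y \<in> univ A" for x y r
    using that by (simp add: brel_ext_iff)
  then show ?thesis
    by (auto simp: embeddings_iff[OF assms(1) ext_structures] incl_def univ_ext inj_on_def)
qed

lemma transport_isos:
  assumes "bij_betw g (points A) (points B)"
    and "\<And>s t r. s \<in> points A \<Longrightarrow> t \<in> points A \<Longrightarrow> (g s, g t) \<in> point_rel B r \<longleftrightarrow> (s, t) \<in> point_rel A r"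
  shows "transport A g \<in> isos (ext A) (ext B)"
proof -
  have g: "g ` points A = points B" "inj_on g (points A)"
    using assms(1) by (auto simp: bij_betw_def)
  have "inj_on (transport A g) (univ (ext A))"
    using g(2) by (auto intro!: inj_onI simp: univ_ext transport_to_nat dest: inj_onD)
  moreover have "transport A g ` univ (ext A) = univ (ext B)"
  proof -
    have "transport A g ` univ (ext A) = to_nat ` g ` points A"
      unfolding univ_ext image_image by (intro image_cong) (simp_all add: transport_to_nat)
    then show ?thesis
      by (simp only: g(1) univ_ext)
  qed
  moreover have "(transport A g x, transport A g y) \<in> brel (ext B) r \<longleftrightarrow> (x, y) \<in> brel (ext A) r"
    if xy: "x \<in> univ (ext A)" "y \<in> univ (ext A)" for x y r
  proof -
    obtain s t where "x = to_nat s" "s \<in> points A" "y = to_nat t" "t \<in> points A"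
      using xy unfolding univ_ext by blast
    moreover from this have "g s \<in> points B" "g t \<in> points B"
      using g(1) by blast+
    ultimately show ?thesis
      using assms(2)[of s t r] by (simp only: transport_to_nat brel_ext_iff)
  qed
  moreover have "transport A g \<in> extensional (univ (ext A))"
    by (simp add: transport_def)
  ultimately show ?thesis
    by (simp add: isos_iff[OF ext_structures ext_structures] bij_betw_def)
qed

section \<open>Isomorphisms and the shift act on extensions\<close>

context
  fixes A B :: "order_sym rstruct" and f :: "nat \<Rightarrow> nat"
  assumes A: "A \<in> structures order_arity" and B: "B \<in> structures order_arity"
    and f: "f \<in> isos A B"
begin

lemma bij_map_point: "bij_betw (map_point f) (points A) (points B)"
proof -
  have bij: "bij_betw f (univ A) (univ B)"
    and brel: "\<And>r x y. x \<in> univ A \<Longrightarrow> y \<in> univ A \<Longrightarrow> (f x, f y) \<in> brel B r \<longleftrightarrow> (x, y) \<in> brel A r"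
    using f isos_iff[OF A B] by auto
  \<comment> \<open>Consistency is only known to be pushed forward, so surjectivity on points uses
    the inverse isomorphism.\<close>
  define g where "g = inv_into (univ A) f"
  have bij': "bij_betw g (univ B) (univ A)"
    unfolding g_def by (rule bij_betw_inv_into[OF bij])
  have fg: "f (g y) = y" "g y \<in> univ A" if "y \<in> univ B" for y
    using that bij bij' unfolding g_def by (auto simp: bij_betw_inv_into_right bij_betwE)
  have brel': "(g x, g y) \<in> brel A r \<longleftrightarrow> (x, y) \<in> brel B r" if "x \<in> univ B" "y \<in> univ B" for r x y
    using brel[of "g x" "g y" r] fg that by simp
  show ?thesis
    unfolding bij_betw_def
  proof (intro conjI equalityI subsetI)
    show "inj_on (map_point f) (points A)"
      by (rule inj_onI) (use map_point_inject[OF bij_betw_imp_inj_on[OF bij]] in blast)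
    show "s \<in> points B" if "s \<in> map_point f ` points A" for s
      using that consistent_map_point[OF bij_betw_imp_inj_on[OF bij] equalityD1[OF bij_betw_imp_surj_on[OF bij]] brel brel]
      by auto
    show "s \<in> map_point f ` points A" if s: "s \<in> points B" for s
    proof
      show "map_point g s \<in> points A"
        using s consistent_map_point[OF bij_betw_imp_inj_on[OF bij'] equalityD1[OF bij_betw_imp_surj_on[OF bij']] brel' brel']
        by simp
      have "set_point s \<subseteq> univ B"
        using s set_point_consistent by blast
      then have "map_point (f \<circ> g) s = map_point id s"
        by (intro point.map_cong0) (auto simp: fg)
      then show "s = map_point f (map_point g s)"
        by (simp add: point.map_comp point.map_id)
    qed
  qed
qed

lemma map_point_in_point_rel:
  assumes "s \<in> points A" "t \<in> points A"
  shows "(map_point f s, map_point f t) \<in> point_rel B r \<longleftrightarrow> (s, t) \<in> point_rel A r"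
proof -
  have inj: "inj_on f (univ A)" and img: "f ` univ A \<subseteq> univ B"
    and brel: "\<And>r x y. x \<in> univ A \<Longrightarrow> y \<in> univ A \<Longrightarrow> (f x, f y) \<in> brel B r \<longleftrightarrow> (x, y) \<in> brel A r"
    using f isos_iff[OF A B] by (auto simp: bij_betw_def)
  show ?thesis
    using map_point_in_lin[OF inj img brel brel] map_point_in_part[OF inj img brel brel] assms
    by (cases r) auto
qed

end

lemma bij_shift: "bij_betw shift (points A) (points A)"
  by (rule bij_betw_byWitness[where f' = unshift]) auto

lemma shift_in_point_rel [simp]: "(shift s, shift t) \<in> point_rel A r \<longleftrightarrow> (s, t) \<in> point_rel A r"
  by (cases r) auto

lemma transport_map_point_isos:
  assumes "A \<in> structures order_arity" "B \<in> structures order_arity" "f \<in> isos A B"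
  shows "transport A (map_point f) \<in> isos (ext A) (ext B)"
  by (intro transport_isos bij_map_point map_point_in_point_rel assms)

lemma transport_shift_auts:
  assumes "A \<in> structures order_arity" "f \<in> auts A"
  shows "transport A (shift \<circ> map_point f) \<in> auts (ext A)"
  using assms unfolding auts_def
  by (intro transport_isos bij_betw_trans[OF bij_map_point bij_shift])
    (simp_all only: o_apply shift_in_point_rel map_point_in_point_rel)

section \<open>Realizing types\<close>

text \<open>Formulas are Boolean combinations of equalities and binary atoms, so agreement on atoms
  with parameters in \<open>F\<close> is enough.\<close>

lemma sat_cong:
  assumes "wf_qf order_arity \<psi>" "params \<psi> \<subseteq> F"
    and "\<And>s t. params_trm s \<subseteq> F \<Longrightarrow> params_trm t \<subseteq> F \<Longrightarrow>
      val e b s = val e b t \<longleftrightarrow> val e' b' s = val e' b' t"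
    and "\<And>r s t. params_trm s \<subseteq> F \<Longrightarrow> params_trm t \<subseteq> F \<Longrightarrow>
      (val e b s, val e b t) \<in> brel B r \<longleftrightarrow> (val e' b' s, val e' b' t) \<in> brel C r"
  shows "sat B e b \<psi> \<longleftrightarrow> sat C e' b' \<psi>"
  using assms(1,2)
proof (induction \<psi>)
  case (Rel r ts)
  then have "length ts = Suc (Suc 0)"
    by (simp add: order_arity_def)
  then obtain s t where "ts = [s, t]"
    by (auto simp: length_Suc_conv)
  then show ?case
    using Rel assms(4)[of s t r] by (simp add: brel_def)
qed (use assms(3) in auto)

text \<open>
  The new point goes immediately above the largest parameter below \<open>b\<close>. It need not have the
  same cut as \<open>b\<close> in the rest of \<open>A\<close>.
\<close>

lemma new_point:
  assumes "A \<in> linear_extensions" "B \<in> linear_extensions" "e \<in> embeddings A B"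
    and "b \<in> univ B" "finite F" "F \<subseteq> univ A" "b \<notin> e ` F"
  obtains p D U where "New p D U 0 \<in> points A"
    and "\<And>r c. c \<in> F \<Longrightarrow> (Old c, New p D U 0) \<in> point_rel A r \<longleftrightarrow> (e c, b) \<in> brel B r"
    and "\<And>r c. c \<in> F \<Longrightarrow> (New p D U 0, Old c) \<in> point_rel A r \<longleftrightarrow> (b, e c) \<in> brel B r"
proof -
  interpret A: linear_extension "univ A" "brel A Lin" "brel A Part"
    using linear_extension_brel assms(1) .
  interpret B: linear_extension "univ B" "brel B Lin" "brel B Part"
    using linear_extension_brel assms(2) .
  have inj: "inj_on e (univ A)" and e_univ: "\<And>x. x \<in> univ A \<Longrightarrow> e x \<in> univ B"
    and brel: "\<And>r x y. x \<in> univ A \<Longrightarrow> y \<in> univ A \<Longrightarrow> (e x, e y) \<in> brel B r \<longleftrightarrow> (x, y) \<in> brel A r"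
    using assms(3) embeddings_iff[OF assms(1,2)[THEN linear_extensions_structures]] by auto
  define L where "L = {c \<in> F. (e c, b) \<in> brel B Lin}"
  have L_lt: "(c, x) \<in> brel A Lin" if "c \<in> L" "x \<in> F" "x \<notin> L" for c x
  proof -
    have x: "x \<in> univ A" and c: "c \<in> univ A" and cb: "(e c, b) \<in> brel B Lin"
      using that assms(6) by (auto simp: L_def)
    have "(e x, b) \<notin> brel B Lin" "e x \<noteq> b"
      using that assms(7) by (auto simp: L_def)
    then have "(b, e x) \<in> brel B Lin"
      using B.total_r e_univ[OF x] assms(4) by (auto simp: total_on_def)
    then have "(e c, e x) \<in> brel B Lin"
      using cb B.trans_r by (metis transD)
    then show ?thesis
      using brel[OF c x] by simp
  qed
  \<comment> \<open>\<open>p\<close> is the singleton list of the largest parameter below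
    \<open>b\<close>, or \<open>[]\<close>, which precedes every \<open>[c]\<close>, if there is
    none. If \<open>[c] = p\<close>, then \<open>[[c]]\<close> is a proper prefix of the new key and
    still precedes it.\<close>
  obtain p where p: "set p \<subseteq> F"
    and below: "\<And>c. c \<in> L \<Longrightarrow> ([c], p) \<in> lexord (brel A Lin) \<or> [c] = p"
    and above: "\<And>c. c \<in> F \<Longrightarrow> c \<notin> L \<Longrightarrow> (p, [c]) \<in> lexord (brel A Lin)"
  proof (cases "L = {}")
    case True
    show ?thesis
      by (rule that[of "[]"]) (use True in auto)
  next
    case False
    have "\<exists>a\<in>L. \<forall>c\<in>L. c \<noteq> a \<longrightarrow> (c, a) \<in> brel A Lin"
    proof (rule Finite_Set.bex_greatest_element)
      show "finite L"
        using assms(5) by (simp add: L_def)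
      show "transp_on L (\<lambda>x y. (x, y) \<in> brel A Lin)"
        using A.trans_r by (auto intro!: transp_onI dest: transD)
      show "totalp_on L (\<lambda>x y. (x, y) \<in> brel A Lin)"
        using A.total_r assms(6) by (auto simp: totalp_on_def total_on_def L_def)
    qed (use False in simp)
    then obtain a where a: "a \<in> L" "\<And>c. c \<in> L \<Longrightarrow> c \<noteq> a \<Longrightarrow> (c, a) \<in> brel A Lin"
      by blast
    show ?thesis
      by (rule that[of "[a]"]) (use a L_lt in \<open>auto simp: L_def\<close>)
  qed
  \<comment> \<open>Taking all parameters related to \<open>b\<close> makes \<open>D\<close>
    downward and \<open>U\<close> upward closed within \<open>F\<close>, so the existential in
    \<open>part\<close> reduces below to membership.\<close>
  obtain D where D: "set D = {c \<in> F. (e c, b) \<in> brel B Part}"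
    using assms(5) by (metis finite_Collect_conjI finite_list Collect_mem_eq)
  obtain U where U: "set U = {c \<in> F. (b, e c) \<in> brel B Part}"
    using assms(5) by (metis finite_Collect_conjI finite_list Collect_mem_eq)
  have not_below: "c \<notin> L" if "(b, e c) \<in> brel B Lin" for c
    using that B.trans_r B.irrefl_r by (auto simp: L_def irrefl_def dest: transD)
  have D_L: "set D \<subseteq> L"
    using D B.q_subset by (auto simp: L_def)
  have U_L: "set U \<subseteq> F - L"
    using U B.q_subset not_below by blast
  \<comment> \<open>In \<open>B\<close> the element \<open>b\<close> lies between the images of
    \<open>d\<close> and \<open>u\<close>, and \<open>e\<close> reflects the relation.\<close>
  have "(d, u) \<in> brel A Part" if "d \<in> set D" "u \<in> set U" for d u
    using that D U brel[of d u Part] assms(6) transD[OF B.trans_q] by blast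
  then have consistent: "New p D U 0 \<in> points A"
    using p D U D_L U_L below above assms(6) by (auto simp: subset_iff)
  have lin_lo: "(Old c, New p D U 0) \<in> point_rel A Lin \<longleftrightarrow> (e c, b) \<in> brel B Lin"
    and lin_hi: "(New p D U 0, Old c) \<in> point_rel A Lin \<longleftrightarrow> (b, e c) \<in> brel B Lin"
    if "c \<in> F" for c
  proof -
    have c: "Old c \<in> points A" "e c \<in> univ B" "e c \<noteq> b"
      using that e_univ assms(6,7) by auto
    have "(Old c, New p D U 0) \<in> lin (brel A Lin)" if "c \<in> L"
      using below[OF that] by (auto simp: lin_def)
    moreover have "(New p D U 0, Old c) \<in> lin (brel A Lin)" if "c \<notin> L"
      using above[OF \<open>c \<in> F\<close> that] by (auto simp: lin_def)
    moreover have "\<not> ((New p D U 0, Old c) \<in> lin (brel A Lin) \<and> (Old c, New p D U 0) \<in> lin (brel A Lin))"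
      using A.trans_lin A.irrefl_lin by (metis irreflD transD)
    moreover have "c \<in> L \<longleftrightarrow> (e c, b) \<in> brel B Lin"
      using that by (simp add: L_def)
    moreover have "(b, e c) \<in> brel B Lin \<longleftrightarrow> (e c, b) \<notin> brel B Lin"
      using c(2,3) assms(4) B.total_r B.trans_r B.irrefl_r
      by (metis irreflD transD total_on_def)
    ultimately show "(Old c, New p D U 0) \<in> point_rel A Lin \<longleftrightarrow> (e c, b) \<in> brel B Lin"
      "(New p D U 0, Old c) \<in> point_rel A Lin \<longleftrightarrow> (b, e c) \<in> brel B Lin"
      by auto
  qed
  have part_lo: "(Old c, New p D U 0) \<in> point_rel A Part \<longleftrightarrow> (e c, b) \<in> brel B Part" if "c \<in> F" for c
  proof -
    have "(\<exists>d\<in>set D. c = d \<or> (c, d) \<in> brel A Part) \<longleftrightarrow> c \<in> set D"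
      using that D brel[of c _ Part] assms(6) transD[OF B.trans_q] by blast
    then show ?thesis
      using that D by (auto simp: part_def)
  qed
  have part_hi: "(New p D U 0, Old c) \<in> point_rel A Part \<longleftrightarrow> (b, e c) \<in> brel B Part" if "c \<in> F" for c
  proof -
    have "(\<exists>u\<in>set U. u = c \<or> (u, c) \<in> brel A Part) \<longleftrightarrow> c \<in> set U"
      using that U brel[of _ c Part] assms(6) transD[OF B.trans_q] by blast
    then show ?thesis
      using that U by (auto simp: part_def)
  qed
  show ?thesis
  proof (rule that[OF consistent])
    show "(Old c, New p D U 0) \<in> point_rel A r \<longleftrightarrow> (e c, b) \<in> brel B r" if "c \<in> F" for r c
      using lin_lo part_lo that by (cases r) auto
    show "(New p D U 0, Old c) \<in> point_rel A r \<longleftrightarrow> (b, e c) \<in> brel B r" if "c \<in> F" for r c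
      using lin_hi part_hi that by (cases r) auto
  qed
qed

lemma brel_irrefl:
  assumes "A \<in> linear_extensions"
  shows "(x, x) \<notin> brel A r"
  using assms by (cases r) (auto simp: linear_extensions_def strict_linear_order_on_def irrefl_def)

lemma ext_realizes:
  assumes A: "A \<in> linear_extensions" and "admissible_type order_arity linear_extensions A \<tau>"
  shows "\<exists>y\<in>univ (ext A). realizes (ext A) (incl A) y \<tau>"
proof -
  define F where "F = (\<Union>\<psi>\<in>\<tau>. params \<psi>)"
  obtain B e b where wf: "\<forall>\<psi>\<in>\<tau>. wf_qf order_arity \<psi>" and F: "finite F" "F \<subseteq> univ A"
    and B: "B \<in> linear_extensions" and e: "e \<in> embeddings A B" and b: "b \<in> univ B"
    and sat: "\<forall>\<psi>\<in>\<tau>. sat B e b \<psi>"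
    using assms(2) unfolding admissible_type_def F_def realizes_def by blast
  note structs = A[THEN linear_extensions_structures] B[THEN linear_extensions_structures]
  have incl: "incl A \<in> embeddings A (ext A)"
    using incl_embedding A by (simp add: linear_extensions_def)
  have e_inj: "e x = e y \<longleftrightarrow> incl A x = incl A y"
    and e_brel: "(e x, e y) \<in> brel B r \<longleftrightarrow> (incl A x, incl A y) \<in> brel (ext A) r"
    if "x \<in> univ A" "y \<in> univ A" for x y r
    using that e incl
    by (auto simp: embeddings_iff[OF structs] embeddings_iff[OF structs(1) ext_structures] inj_on_eq_iff)
  \<comment> \<open>One \<open>y\<close> copies all atomic facts about \<open>b\<close> over
    \<open>F\<close>: an old point if \<open>b\<close> is the image of a parameter, a new point
    otherwise.\<close>
  have "\<exists>y\<in>univ (ext A). \<forall>s t. params_trm s \<subseteq> F \<longrightarrow> params_trm t \<subseteq> F \<longrightarrow>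
      (val e b s = val e b t \<longleftrightarrow> val (incl A) y s = val (incl A) y t) \<and>
      (\<forall>r. (val e b s, val e b t) \<in> brel B r \<longleftrightarrow>
        (val (incl A) y s, val (incl A) y t) \<in> brel (ext A) r)"
  proof (cases "b \<in> e ` F")
    case True
    then obtain a where a: "a \<in> F" "b = e a"
      by blast
    \<comment> \<open>\<open>h\<close> puts \<open>a\<close> for the variable, turning terms into
      elements of \<open>A\<close>, where both embeddings agree on atomic facts.\<close>
    define h where "h = case_trm a id"
    have h: "val e b s = e (h s)" "val (incl A) (incl A a) s = incl A (h s)" for s
      using a by (cases s; simp add: h_def)+
    have h_univ: "h s \<in> univ A" if "params_trm s \<subseteq> F" for s
      using that a(1) F(2) by (cases s) (auto simp: h_def)
    show ?thesis
    proof (rule bexI[of _ "incl A a"])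
      show "incl A a \<in> univ (ext A)"
        using a(1) F(2) by (auto simp: incl_def univ_ext)
    qed (use h_univ e_inj e_brel in \<open>auto simp: h\<close>)
  next
    case False
    obtain p D U where consistent: "New p D U 0 \<in> points A"
      and lo: "\<And>r c. c \<in> F \<Longrightarrow> (Old c, New p D U 0) \<in> point_rel A r \<longleftrightarrow> (e c, b) \<in> brel B r"
      and hi: "\<And>r c. c \<in> F \<Longrightarrow> (New p D U 0, Old c) \<in> point_rel A r \<longleftrightarrow> (b, e c) \<in> brel B r"
      using new_point[OF A B e b F False] by metis
    define y where "y = to_nat (New p D U 0)"
    have F_incl: "incl A c = to_nat (Old c)" "Old c \<in> points A" if "c \<in> F" for c
      using that F(2) by (auto simp: incl_def)
    have y: "y \<noteq> incl A c" "(incl A c, y) \<in> brel (ext A) r \<longleftrightarrow> (e c, b) \<in> brel B r"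
      "(y, incl A c) \<in> brel (ext A) r \<longleftrightarrow> (b, e c) \<in> brel B r" if "c \<in> F" for c r
      using lo hi brel_ext_iff[OF F_incl(2)[OF that] consistent] brel_ext_iff[OF consistent F_incl(2)[OF that]] that
      by (simp_all add: y_def F_incl)
    \<comment> \<open>These settle the atoms relating the variable to itself.\<close>
    have irrefl: "(b, b) \<notin> brel B r" "(y, y) \<notin> brel (ext A) r" for r
      using brel_irrefl B ext_linear_extensions[OF A] by blast+
    have b_neq: "b \<noteq> e c" if "c \<in> F" for c
      using that False by blast
    have F_univ: "c \<in> univ A" if "c \<in> F" for c
      using that F(2) by blast
    show ?thesis
    proof (rule bexI[of _ y], intro allI impI conjI)
      show "y \<in> univ (ext A)"
        using consistent by (simp add: y_def univ_ext)
      fix s t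
      assume s: "params_trm s \<subseteq> F" and t: "params_trm t \<subseteq> F"
      show "val e b s = val e b t \<longleftrightarrow> val (incl A) y s = val (incl A) y t"
        using s t b_neq y(1) by (cases s; cases t) (auto simp: e_inj F_univ)
      show "(val e b s, val e b t) \<in> brel B r \<longleftrightarrow>
          (val (incl A) y s, val (incl A) y t) \<in> brel (ext A) r" for r
        using s t irrefl y(2,3) by (cases s; cases t) (auto simp: e_brel F_univ)
    qed
  qed
  then obtain y where y: "y \<in> univ (ext A)"
    and eq: "\<And>s t. params_trm s \<subseteq> F \<Longrightarrow> params_trm t \<subseteq> F \<Longrightarrow>
      val e b s = val e b t \<longleftrightarrow> val (incl A) y s = val (incl A) y t"
    and rel: "\<And>r s t. params_trm s \<subseteq> F \<Longrightarrow> params_trm t \<subseteq> F \<Longrightarrow>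
      (val e b s, val e b t) \<in> brel B r \<longleftrightarrow>
      (val (incl A) y s, val (incl A) y t) \<in> brel (ext A) r"
    by blast
  have "sat (ext A) (incl A) y \<psi>" if "\<psi> \<in> \<tau>" for \<psi>
  proof -
    have "params \<psi> \<subseteq> F"
      using that by (auto simp: F_def)
    then show ?thesis
      using sat_cong[OF _ _ eq rel] wf sat that by blast
  qed
  then show ?thesis
    using y by (auto simp: realizes_def)
qed

section \<open>Measurability\<close>

text \<open>Singletons are closed, so on a countable space every set is Borel. This ties Borel maps
  to \<open>Measurable.pred\<close>, whose target is discrete.\<close>

lemma measurable_count_space_iff_borel:
  "f \<in> M \<rightarrow>\<^sub>M count_space UNIV \<longleftrightarrow> f \<in> M \<rightarrow>\<^sub>M (borel :: ('a :: {countable, t2_space}) measure)"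
  by (simp add: measurable_cong_sets[OF refl sets_borel_eq_count_space])

lemma measurable_into_struct_borel:
  assumes "\<And>x. x \<in> space M \<Longrightarrow> E x \<in> K"
    and "\<And>n. Measurable.pred M (\<lambda>x. n \<in> univ (E x))"
    and "\<And>r xs. Measurable.pred M (\<lambda>x. xs \<in> rels (E x) r)"
  shows "E \<in> M \<rightarrow>\<^sub>M struct_borel K"
  unfolding struct_borel_def
proof (rule measurable_vimage_algebra2)
  have "(\<lambda>x n. n \<in> univ (E x)) \<in> borel_measurable M"
    using assms(2) by (intro measurable_coordinatewise_then_product) (simp add: measurable_count_space_iff_borel)
  moreover have "(\<lambda>x. (\<lambda>(r, xs). xs \<in> rels (E x) r)) \<in> borel_measurable M"
    using assms(3) by (intro measurable_coordinatewise_then_product) (auto simp: measurable_count_space_iff_borel)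
  ultimately show "(\<lambda>x. char_code (E x)) \<in> borel_measurable M"
    unfolding char_code_def by (rule borel_measurable_Pair)
qed (use assms(1) in auto)

lemma space_struct_borel [simp]: "space (struct_borel K) = K"
  by (simp add: struct_borel_def)

lemma measurable_char_code: "char_code \<in> struct_borel K \<rightarrow>\<^sub>M borel"
  unfolding struct_borel_def by (rule measurable_vimage_algebra1) simp

text \<open>Evaluating a code at one coordinate is continuous.\<close>

lemma pred_univ [measurable]: "Measurable.pred (struct_borel K) (\<lambda>A. n \<in> univ A)"
proof -
  have "(\<lambda>c. fst c n) \<in> borel_measurable (borel :: ((nat \<Rightarrow> bool) \<times> ('a \<times> nat list \<Rightarrow> bool)) measure)"
    by (rule borel_measurable_continuous_onI,
      rule continuous_on_product_then_coordinatewise[OF continuous_on_fst[OF continuous_on_id]])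
  from measurable_compose[OF measurable_char_code this] show ?thesis
    by (simp add: measurable_count_space_iff_borel char_code_def)
qed

lemma pred_rels [measurable]: "Measurable.pred (struct_borel K) (\<lambda>A. xs \<in> rels A r)"
proof -
  have "(\<lambda>c. snd c (r, xs)) \<in> borel_measurable (borel :: ((nat \<Rightarrow> bool) \<times> ('a \<times> nat list \<Rightarrow> bool)) measure)"
    by (rule borel_measurable_continuous_onI,
      rule continuous_on_product_then_coordinatewise[OF continuous_on_snd[OF continuous_on_id]])
  from measurable_compose[OF measurable_char_code this] show ?thesis
    by (simp add: measurable_count_space_iff_borel char_code_def)
qed

lemma pred_brel [measurable]: "Measurable.pred (struct_borel K) (\<lambda>A. x \<in> brel A r)"
  by (cases x) (simp add: brel_def pred_rels)

text \<open>For fixed lists this is a finite Boolean combination of atoms. The family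
  \<open>R\<close> is arbitrary, so the lemma can be iterated for
  \<open>lexord (lexord r)\<close>.\<close>

lemma pred_lexord [measurable (raw)]:
  assumes "\<And>a b. Measurable.pred M (\<lambda>A. (a, b) \<in> R A)"
  shows "Measurable.pred M (\<lambda>A. (xs, ys) \<in> lexord (R A))"
proof (induction xs arbitrary: ys)
  case Nil
  then show ?case by (cases ys) simp_all
next
  case (Cons x xs)
  note [measurable] = assms Cons
  show ?case
    by (cases ys) simp_all
qed

lemma pred_consistent [measurable]:
  "Measurable.pred (struct_borel K) (\<lambda>A. consistent (univ A) (brel A Lin) (brel A Part) s)"
  by (cases s) (simp_all del: lexord_cons_cons)

lemma pred_point_rel [measurable]: "Measurable.pred (struct_borel K) (\<lambda>A. (s, t) \<in> point_rel A r)"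
  by (cases r) (simp_all add: lin_def part_def lex_prod_def case_prod_beta)

text \<open>Points form a countable type, so the existentials over them are countable unions of
  Borel conditions on \<open>A\<close>.\<close>

lemma measurable_ext: "ext \<in> struct_borel linear_extensions \<rightarrow>\<^sub>M struct_borel linear_extensions"
proof (rule measurable_into_struct_borel)
  show "Measurable.pred (struct_borel linear_extensions) (\<lambda>A. n \<in> univ (ext A))" for n
    unfolding univ_ext image_iff Bex_def by measurable
  show "Measurable.pred (struct_borel linear_extensions) (\<lambda>A. xs \<in> rels (ext A) r)" for r xs
    unfolding ext_def rstruct.simps mem_Collect_eq by measurable
qed (simp add: ext_linear_extensions)

lemma measurable_incl: "incl \<in> struct_borel K \<rightarrow>\<^sub>M borel"
proof (rule measurable_coordinatewise_then_product)
  show "(\<lambda>A. incl A n) \<in> borel_measurable (struct_borel K)" for n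
    unfolding incl_def restrict_def by measurable
qed

lemma pred_map:
  assumes "\<And>i y. Measurable.pred M (\<lambda>x. f x i = y)"
  shows "Measurable.pred M (\<lambda>x. map (f x) xs = ys)"
proof (induction xs arbitrary: ys)
  case (Cons i xs)
  note [measurable] = assms Cons
  show ?case
    by (cases ys) simp_all
qed simp

text \<open>The target is countable, so fibres suffice, and each fibre constrains only finitely many
  values of \<open>\<phi>\<close>.\<close>

lemma measurable_map_point:
  "(\<lambda>\<phi>. map_point \<phi> s) \<in> (borel :: (nat \<Rightarrow> nat) measure) \<rightarrow>\<^sub>M count_space UNIV"
proof -
  have "(\<lambda>\<phi> :: nat \<Rightarrow> nat. \<phi> i) \<in> borel \<rightarrow>\<^sub>M count_space UNIV" for i
    unfolding measurable_count_space_iff_borel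
    by (intro borel_measurable_continuous_onI continuous_on_product_coordinates)
  then have [measurable]: "Measurable.pred borel (\<lambda>\<phi> :: nat \<Rightarrow> nat. \<phi> i = y)" for i y
    by measurable
  have [measurable]: "Measurable.pred borel (\<lambda>\<phi> :: nat \<Rightarrow> nat. map \<phi> xs = ys)" for xs ys
    by (rule pred_map) measurable
  have "Measurable.pred borel (\<lambda>\<phi> :: nat \<Rightarrow> nat. map_point \<phi> s = t)" for t
    by (cases s; cases t) simp_all
  then have "{\<phi> :: nat \<Rightarrow> nat. map_point \<phi> s = t} \<in> sets borel" for t
    unfolding pred_def by simp
  then show ?thesis
    by (simp add: measurable_count_space_eq2_countable vimage_def)
qed

lemma measurable_transport:
  "(\<lambda>(A, \<phi>). transport A (shift \<circ> map_point \<phi>)) \<in> aut_borel linear_extensions \<rightarrow>\<^sub>M borel"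
  unfolding aut_borel_def
proof (intro measurable_restrict_space1 measurable_coordinatewise_then_product)
  fix n
  have "Measurable.pred (struct_borel linear_extensions) (\<lambda>A. n \<in> univ (ext A))"
    by (rule measurable_compose[OF measurable_ext pred_univ])
  from measurable_compose[OF measurable_fst this]
  have [measurable]: "Measurable.pred (struct_borel linear_extensions \<Otimes>\<^sub>M borel) (\<lambda>p. n \<in> univ (ext (fst p)))" .
  \<comment> \<open>The value at \<open>n\<close> depends on \<open>A\<close> only through
    membership of \<open>n\<close> in the extension; otherwise it is a function of
    \<open>\<phi>\<close>.\<close>
  have "(\<lambda>\<phi>. to_nat (shift (map_point \<phi> s))) \<in> borel_measurable (borel :: (nat \<Rightarrow> nat) measure)" for s
    by (rule measurable_compose[OF measurable_map_point borel_measurable_count_space])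
  from measurable_compose[OF measurable_snd this]
  have [measurable]: "(\<lambda>p. to_nat (shift (map_point (snd p) (from_nat n))))
    \<in> borel_measurable (struct_borel linear_extensions \<Otimes>\<^sub>M (borel :: (nat \<Rightarrow> nat) measure))" .
  show "(\<lambda>p. (case p of (A, \<phi>) \<Rightarrow> transport A (shift \<circ> map_point \<phi>)) n)
    \<in> borel_measurable (struct_borel linear_extensions \<Otimes>\<^sub>M borel)"
    unfolding transport_def restrict_def case_prod_beta o_apply
    by measurable
qed

section \<open>The class is Borel; assembling the amalgamation property\<close>

lemma borel_class_linear_extensions: "borel_class order_arity linear_extensions"
  unfolding borel_class_def
proof (intro conjI ballI impI)
  let ?M = "struct_borel (structures order_arity)"
  \<comment> \<open>The axioms quantify over naturals only, which gives countable
    intersections.\<close>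
  have irrefl: "Measurable.pred ?M (\<lambda>A. irrefl (brel A r))" for r
    unfolding irrefl_def by measurable
  have trans: "Measurable.pred ?M (\<lambda>A. trans (brel A r))" for r
    unfolding trans_def by measurable
  have total: "Measurable.pred ?M (\<lambda>A. total_on (univ A) (brel A r))" for r
    unfolding total_on_def Ball_def by measurable
  have subset: "Measurable.pred ?M (\<lambda>A. brel A r \<subseteq> brel A r')" for r r'
    unfolding subset_iff by measurable
  have "Measurable.pred ?M (\<lambda>A.
     irrefl (brel A Part) \<and> trans (brel A Part) \<and>
     strict_linear_order_on (univ A) (brel A Lin) \<and> brel A Part \<subseteq> brel A Lin)"
    unfolding strict_linear_order_on_def
    by (intro pred_intros_logic irrefl trans total subset)
  then show "linear_extensions \<in> sets ?M"
    by (simp add: pred_def linear_extensions_def)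
  show "B \<in> linear_extensions"
    if "A \<in> linear_extensions" "B \<in> structures order_arity" "isos A B \<noteq> {}" for A B
    using linear_extensions_iso_closed that by blast
qed

theorem theorem6p1:
  shows "ABAP order_arity linear_extensions"
  unfolding ABAP_def
proof (intro conjI exI ballI allI impI)
  show "borel_class order_arity linear_extensions"
    by (rule borel_class_linear_extensions)
  show "ext \<in> struct_borel linear_extensions \<rightarrow>\<^sub>M struct_borel linear_extensions"
    by (rule measurable_ext)
  show "incl \<in> struct_borel linear_extensions \<rightarrow>\<^sub>M borel"
    by (rule measurable_incl)
  show "(\<lambda>(A, \<phi>). transport A (shift \<circ> map_point \<phi>)) \<in> aut_borel linear_extensions \<rightarrow>\<^sub>M borel"
    by (rule measurable_transport)
next
  fix A
  assume A: "A \<in> linear_extensions"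
  show "ext A \<in> linear_extensions"
    by (rule ext_linear_extensions[OF A])
  show "incl A \<in> embeddings A (ext A)"
    using A by (intro incl_embedding) (simp_all add: linear_extensions_def)
  show "\<exists>b\<in>univ (ext A). realizes (ext A) (incl A) b \<tau>"
    if "admissible_type order_arity linear_extensions A \<tau>" for \<tau>
    by (rule ext_realizes[OF A that])
  fix \<phi>
  assume \<phi>: "\<phi> \<in> auts A"
  show "transport A (shift \<circ> map_point \<phi>) \<in> auts (ext A)"
    by (rule transport_shift_auts[OF linear_extensions_structures[OF A] \<phi>])
  show "transport A (shift \<circ> map_point \<phi>) (incl A x) = incl A (\<phi> x)" if "x \<in> univ A" for x
  proof -
    have "\<phi> x \<in> univ A"
      using \<phi> that by (auto simp: auts_def isos_def)
    then show ?thesis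
      using that by (simp add: incl_def transport_to_nat)
  qed
  show "transport A (shift \<circ> map_point \<phi>) y \<noteq> y" if y: "y \<in> univ (ext A) - incl A ` univ A" for y
  proof -
    obtain s where s: "s \<in> points A" "y = to_nat s"
      using y unfolding univ_ext by blast
    have "s \<noteq> Old a" for a
      using s y by (auto simp: incl_def)
    \<comment> \<open>\<open>map_point\<close> leaves the integer of a new point alone and
      \<open>shift\<close> raises it by one.\<close>
    then have "shift (map_point \<phi> s) \<noteq> s"
      by (cases s) auto
    then show ?thesis
      unfolding s(2) using s(1) by (simp add: transport_to_nat)
  qed
next
  fix A B \<alpha>
  assume A: "A \<in> linear_extensions" and B: "B \<in> linear_extensions" and \<alpha>: "\<alpha> \<in> isos A B"
  note structs = A[THEN linear_extensions_structures] B[THEN linear_extensions_structures]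
  \<comment> \<open>The hat carries no shift, so each side of the intertwining equation contains
    exactly one.\<close>
  show "transport A (map_point \<alpha>) \<in> isos (ext A) (ext B)"
    by (rule transport_map_point_isos[OF structs \<alpha>])
  show "transport A (map_point \<alpha>) (incl A x) = incl B (\<alpha> x)" if "x \<in> univ A" for x
  proof -
    have "\<alpha> x \<in> univ B"
      using \<alpha> that by (auto simp: isos_def)
    then show ?thesis
      using that by (simp add: incl_def transport_to_nat)
  qed
  fix \<phi> \<psi> y
  assume \<phi>: "\<phi> \<in> auts A" and "\<psi> \<in> auts B" and eq: "\<forall>x\<in>univ A. \<alpha> (\<phi> x) = \<psi> (\<alpha> x)"
    and "y \<in> univ (ext A)"
  then obtain s where s: "s \<in> points A" "y = to_nat s"
    unfolding univ_ext by blast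
  have "map_point \<phi> s \<in> points A" "map_point \<alpha> s \<in> points B"
    using bij_map_point[OF structs(1,1)] bij_map_point[OF structs \<alpha>] \<phi> s(1)
    unfolding auts_def by (meson bij_betwE)+
  \<comment> \<open>The two composites agree only on \<open>univ A\<close>, which contains every
    element occurring in \<open>s\<close>.\<close>
  moreover have "map_point (\<alpha> \<circ> \<phi>) s = map_point (\<psi> \<circ> \<alpha>) s"
  proof (rule point.map_cong0)
    fix x
    assume "x \<in> set_point s"
    then have "x \<in> univ A"
      using set_point_consistent s(1) by blast
    then show "(\<alpha> \<circ> \<phi>) x = (\<psi> \<circ> \<alpha>) x"
      using eq by simp
  qed
  ultimately show "transport A (map_point \<alpha>) (transport A (shift \<circ> map_point \<phi>) y) =
      transport B (shift \<circ> map_point \<psi>) (transport A (map_point \<alpha>) y)"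
    using s by (simp add: transport_to_nat point.map_comp shift_map_point[symmetric])
qed

end
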